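(* Let $\Lambda\subset\mathbb{N}_0^d$ be an arbitrary finite index set. A rank-1 lattice rule $Q_n^*$ with $n$ points and generating vector $\boldsymbol{z}\in\mathbb{Z}^d$ reconstructs exactly the cosine coefficients of all cosine space functions $f\in\mathcal{F}^{\cos}_\Lambda$ solely supported on $\Lambda$, by $$\widehat f_{\boldsymbol{k}}=\widehat f^{\,c}_{\boldsymbol{k}}:=\frac{Q_n^*\big((f\circ\varphi_{\rm tent})\,\sqrt2^{\,|\boldsymbol{k}|_0}\cos(2\pi\boldsymbol{k}\cdot\,\bullet\,)\big)}{c_{\boldsymbol{k}}},\qquad c_{\boldsymbol{k}}:=\#\{\boldsymbol{\sigma}\in\mathcal{S}_{\boldsymbol{k}}:\boldsymbol{\sigma}(\boldsymbol{k})\cdot\boldsymbol{z}\equiv\boldsymbol{k}\cdot\boldsymbol{z}\ (\mathrm{mod}\ n)\},\qquad\text{for all }\boldsymbol{k}\in\Lambda,$$ if and only if $$\boldsymbol{\sigma}(\boldsymbol{k}')\cdot\boldsymbol{z}\not\equiv\boldsymbol{k}\cdot\boldsymbol{z}\pmod n\qquad\text{for all }\boldsymbol{k},\boldsymbol{k}'\in\Lambda,\ \boldsymbol{\sigma}\in\mathcal{S}_{\boldsymbol{k}'},\ \boldsymbol{k}\ne\boldsymbol{k}'.$$ Such a generating vector $\boldsymbol{z}$ can be constructed component-by-component if $n$ is a prime satisfying $$n>\max\{\#\Lambda\cdot\#\mathcal{M}(\Lambda),\ 2\max(\Lambda)\}.$$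
   Context: Cosine basis: $\phi_{\boldsymbol{k}}(\boldsymbol{x})=\sqrt2^{\,|\boldsymbol{k}|_0}\prod_{j=1}^d\cos(\pi k_jx_j)$ on $[0,1]^d$, $\boldsymbol{k}\in\mathbb{N}_0^d$, with $|\boldsymbol{k}|_0$ the number of nonzero components. $\mathcal{F}^{\cos}_\Lambda$ is the set of real-valued functions $f=\sum_{\boldsymbol{k}\in\Lambda}\widehat f_{\boldsymbol{k}}\,\phi_{\boldsymbol{k}}$ on $[0,1]^d$; the cosine coefficients are $\widehat f_{\boldsymbol{k}}=\int_{[0,1]^d}f\,\phi_{\boldsymbol{k}}\,d\boldsymbol{x}$. The rank-1 lattice rule is $Q_n^*(g)=\frac1n\sum_{i=0}^{n-1}g\big(\frac{i\boldsymbol{z}\bmod n}{n}\big)$ (mod applied componentwise); $\varphi_{\rm tent}(x)=1-|2x-1|$ is applied componentwise; $\cos(2\pi\boldsymbol{k}\cdot\bullet)$ denotes the function $\boldsymbol{x}\mapsto\cos(2\pi\boldsymbol{k}\cdot\boldsymbol{x})$. $\boldsymbol{\sigma}(\boldsymbol{k})=(\sigma_1k_1,\ldots,\sigma_dk_d)$; $\mathcal{S}_{\boldsymbol{k}}=\{\boldsymbol{\sigma}\in\{\pm1\}^d:\sigma_j=+1\text{ if }k_j=0\}$ (and likewise in dimension $s$); $\mathcal{M}(\Lambda)=\{\boldsymbol{\sigma}(\boldsymbol{k}):\boldsymbol{k}\in\Lambda,\boldsymbol{\sigma}\in\{\pm1\}^d\}$; $\max(\Lambda)=\max_{\boldsymbol{k}\in\Lambda}\max_j|k_j|$;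 $\#$ is cardinality. "Constructed component-by-component": let $\Lambda_s=\{\boldsymbol{k}\in\mathbb{N}_0^s:(\boldsymbol{k},\boldsymbol{k}_\perp)\in\Lambda\text{ for some }\boldsymbol{k}_\perp\in\mathbb{N}_0^{d-s}\}$. The components $z_1,\ldots,z_d\in\{1,\ldots,n-1\}$ can be chosen one at a time: whenever $(z_1,\ldots,z_{s-1})$ satisfies $\boldsymbol{\sigma}(\boldsymbol{k}')\cdot(z_1,\ldots,z_{s-1})\not\equiv\boldsymbol{k}\cdot(z_1,\ldots,z_{s-1})\pmod n$ for all $\boldsymbol{k}\ne\boldsymbol{k}'$ in $\Lambda_{s-1}$ and $\boldsymbol{\sigma}\in\mathcal{S}_{\boldsymbol{k}'}$ (no condition if $s=1$), there exists $z_s\in\{1,\ldots,n-1\}$ such that $(z_1,\ldots,z_s)$ satisfies the same condition with $\Lambda_s$. Since $\Lambda_d=\Lambda$, the resulting $\boldsymbol{z}$ satisfies the required condition. *)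

theory Defs
  imports "HOL-Analysis.Analysis" "HOL-Number_Theory.Number_Theory"
begin

text \<open>
  A vector of dimension \<open>d\<close> is a function on \<open>nat\<close> that is extensional on \<open>{..<d}\<close>, so its
  components are numbered \<open>0, \<dots>, d - 1\<close> and different functions are different vectors.  This
  keeps \<open>d\<close> an ordinary number, matches the space of \<open>PiM {..<d} (\<lambda>_. lborel)\<close>, and makes
  cardinalities of sets of vectors meaningful.
\<close>

definition unit_cube :: "nat \<Rightarrow> (nat \<Rightarrow> real) set" where
  "unit_cube d = {..<d} \<rightarrow>\<^sub>E {0..1}"

definition dot :: "nat \<Rightarrow> (nat \<Rightarrow> 'a::comm_semiring_0) \<Rightarrow> (nat \<Rightarrow> 'a) \<Rightarrow> 'a" where
  "dot d a b = (\<Sum>j<d. a j * b j)"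

definition num_nonzero :: "nat \<Rightarrow> (nat \<Rightarrow> nat) \<Rightarrow> nat" where
  "num_nonzero d k = card {j. j < d \<and> k j \<noteq> 0}"

definition cos_basis :: "nat \<Rightarrow> (nat \<Rightarrow> nat) \<Rightarrow> (nat \<Rightarrow> real) \<Rightarrow> real" where
  "cos_basis d k x = sqrt 2 ^ num_nonzero d k * (\<Prod>j<d. cos (pi * real (k j) * x j))"

definition cos_coeff :: "nat \<Rightarrow> ((nat \<Rightarrow> real) \<Rightarrow> real) \<Rightarrow> (nat \<Rightarrow> nat) \<Rightarrow> real" where
  "cos_coeff d f k =
     set_lebesgue_integral (PiM {..<d} (\<lambda>_. lborel)) (unit_cube d) (\<lambda>x. f x * cos_basis d k x)"

text \<open>
  Members are total functions of which only the values on the unit cube are constrained; the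
  coefficients, the lattice points and their tent transforms never look outside the cube.
\<close>

definition cos_space :: "nat \<Rightarrow> (nat \<Rightarrow> nat) set \<Rightarrow> ((nat \<Rightarrow> real) \<Rightarrow> real) set" where
  "cos_space d \<Lambda> =
     {f. \<forall>x\<in>unit_cube d. f x = (\<Sum>k\<in>\<Lambda>. cos_coeff d f k * cos_basis d k x)}"

definition lattice_rule :: "nat \<Rightarrow> nat \<Rightarrow> (nat \<Rightarrow> int) \<Rightarrow> ((nat \<Rightarrow> real) \<Rightarrow> real) \<Rightarrow> real" where
  "lattice_rule d n z g =
     (1 / real n) *
     (\<Sum>i<n. g (\<lambda>j\<in>{..<d}. real_of_int ((int i * z j) mod int n) / real n))"

definition tent :: "nat \<Rightarrow> (nat \<Rightarrow> real) \<Rightarrow> (nat \<Rightarrow> real)" where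
  "tent d x = (\<lambda>j\<in>{..<d}. 1 - \<bar>2 * x j - 1\<bar>)"

definition signs :: "nat \<Rightarrow> (nat \<Rightarrow> int) set" where
  "signs d = {..<d} \<rightarrow>\<^sub>E {1, -1}"

definition signs_at :: "nat \<Rightarrow> (nat \<Rightarrow> nat) \<Rightarrow> (nat \<Rightarrow> int) set" where
  "signs_at d k = {\<sigma> \<in> signs d. \<forall>j<d. k j = 0 \<longrightarrow> \<sigma> j = 1}"

definition flip :: "nat \<Rightarrow> (nat \<Rightarrow> int) \<Rightarrow> (nat \<Rightarrow> nat) \<Rightarrow> (nat \<Rightarrow> int)" where
  "flip d \<sigma> k = (\<lambda>j\<in>{..<d}. \<sigma> j * int (k j))"

definition mirrored :: "nat \<Rightarrow> (nat \<Rightarrow> nat) set \<Rightarrow> (nat \<Rightarrow> int) set" where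
  "mirrored d \<Lambda> = {flip d \<sigma> k | \<sigma> k. k \<in> \<Lambda> \<and> \<sigma> \<in> signs d}"

text \<open>The extra element \<open>0\<close> only fixes the value for an empty index set (or dimension \<open>0\<close>).\<close>

definition max_component :: "nat \<Rightarrow> (nat \<Rightarrow> nat) set \<Rightarrow> nat" where
  "max_component d \<Lambda> = Max (insert 0 {k j | k j. k \<in> \<Lambda> \<and> j < d})"

definition multiplicity_c :: "nat \<Rightarrow> nat \<Rightarrow> (nat \<Rightarrow> int) \<Rightarrow> (nat \<Rightarrow> nat) \<Rightarrow> nat" where
  "multiplicity_c d n z k =
     card {\<sigma> \<in> signs_at d k. [dot d (flip d \<sigma> k) z = dot d (int \<circ> k) z] (mod int n)}"

definition lattice_coeff ::
    "nat \<Rightarrow> nat \<Rightarrow> (nat \<Rightarrow> int) \<Rightarrow> ((nat \<Rightarrow> real) \<Rightarrow> real) \<Rightarrow> (nat \<Rightarrow> nat) \<Rightarrow> real" where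
  "lattice_coeff d n z f k =
     lattice_rule d n z
       (\<lambda>x. f (tent d x) * (sqrt 2 ^ num_nonzero d k * cos (2 * pi * dot d (real \<circ> k) x)))
     / real (multiplicity_c d n z k)"

definition reconstructs :: "nat \<Rightarrow> nat \<Rightarrow> (nat \<Rightarrow> int) \<Rightarrow> (nat \<Rightarrow> nat) set \<Rightarrow> bool" where
  "reconstructs d n z \<Lambda> \<longleftrightarrow>
     (\<forall>f\<in>cos_space d \<Lambda>. \<forall>k\<in>\<Lambda>. cos_coeff d f k = lattice_coeff d n z f k)"

definition reconstruction_condition ::
    "nat \<Rightarrow> nat \<Rightarrow> (nat \<Rightarrow> int) \<Rightarrow> (nat \<Rightarrow> nat) set \<Rightarrow> bool" where
  "reconstruction_condition d n z \<Lambda> \<longleftrightarrow>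
     (\<forall>k\<in>\<Lambda>. \<forall>k'\<in>\<Lambda>. \<forall>\<sigma>\<in>signs_at d k'. k \<noteq> k' \<longrightarrow>
        \<not> [dot d (flip d \<sigma> k') z = dot d (int \<circ> k) z] (mod int n))"

text \<open>The index vectors in \<open>\<nat>\<^sub>0\<^sup>s\<close> that extend to a member of \<open>\<Lambda>\<close>.\<close>

definition initial_indices :: "nat \<Rightarrow> (nat \<Rightarrow> nat) set \<Rightarrow> (nat \<Rightarrow> nat) set" where
  "initial_indices s \<Lambda> = (\<lambda>k. restrict k {..<s}) ` \<Lambda>"

text \<open>
  Component-by-component construction.  With \<open>s\<close> components already chosen, the next one has
  index \<open>s\<close>; for \<open>s = 0\<close> the condition on the chosen components is vacuous.  The second
  conjunct is the result of carrying out all \<open>d\<close> steps.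
\<close>

definition cbc_constructible :: "nat \<Rightarrow> nat \<Rightarrow> (nat \<Rightarrow> nat) set \<Rightarrow> bool" where
  "cbc_constructible d n \<Lambda> \<longleftrightarrow>
     (\<forall>s<d. \<forall>z \<in> {..<s} \<rightarrow>\<^sub>E {1..int n - 1}.
        reconstruction_condition s n z (initial_indices s \<Lambda>) \<longrightarrow>
        (\<exists>c \<in> {1..int n - 1}.
           reconstruction_condition (Suc s) n (z(s := c)) (initial_indices (Suc s) \<Lambda>))) \<and>
     (\<exists>z \<in> {..<d} \<rightarrow>\<^sub>E {1..int n - 1}.
        (\<forall>s\<in>{1..d}. reconstruction_condition s n z (initial_indices s \<Lambda>)) \<and>
        reconstruction_condition d n z \<Lambda>)"

end

theory Submission
  imports Defs
begin

text \<open>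
  The tent transform turns the half-period cosines \<open>cos (\<pi> k x)\<close> into the one-periodic
  \<open>cos (2 \<pi> k x)\<close>, and a product of cosines is the average of characters \<open>exp (2 \<pi> i h \<cdot> x)\<close> over
  the sign changes \<open>h = \<sigma>(k')\<close>.  A rank-1 lattice rule integrates such a character to \<open>1\<close> if
  \<open>h \<cdot> z \<equiv> 0\<close> modulo \<open>n\<close> and to \<open>0\<close> otherwise.  Hence applying the rule to the tent-transformed
  \<open>\<phi>\<^bsub>k'\<^esub>\<close> times \<open>cos (2 \<pi> k \<cdot> x)\<close> counts, up to a nonzero factor, the \<open>\<sigma>\<close> for which \<open>\<sigma>(k')\<close> aliases
  with \<open>k\<close>, that is, \<open>\<sigma>(k') \<cdot> z \<equiv> k \<cdot> z\<close> (lemma \<open>lattice_rule_cos_basis_tent\<close>).  By linearity the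
  approximate coefficient of \<open>f\<close> at \<open>k\<close> is a combination of all coefficients \<open>k'\<close> weighted by these
  counts.  If the counts vanish for \<open>k' \<noteq> k\<close>, only the coefficient at \<open>k\<close> remains, and dividing by
  its own count makes it exact.  Conversely, since the cosine basis is orthonormal, every
  \<open>\<phi>\<^bsub>k'\<^esub>\<close> with \<open>k' \<in> \<Lambda>\<close> is a test function, and exactness on it forces its count at every other
  \<open>k \<in> \<Lambda>\<close> to vanish (lemma \<open>reconstructs_iff\<close>).

  The component-by-component step is a counting argument (lemma
  \<open>reconstruction_condition_extend\<close>).  Consider \<open>k\<close> and \<open>h = \<sigma>(k')\<close> from the projected index set.
  If their last components agree, the new component of \<open>z\<close> cancels from the congruence, which is
  then excluded by the previous step.  Otherwise the last components differ by less than \<open>n\<close> in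
  absolute value, so, \<open>n\<close> being prime, at most one value of the new component solves the
  congruence.  As \<open>h \<noteq> k\<close>, there are at most \<open>#\<Lambda> \<cdot> (#\<M>(\<Lambda>) - 1)\<close> such pairs, fewer than the
  \<open>n - 1\<close> candidates.
\<close>

section \<open>Sign vectors\<close>

lemma signs_at_eq_PiE: "signs_at d k = (\<Pi>\<^sub>E j\<in>{..<d}. if k j = 0 then {1} else {1, -1})"
proof (rule Set.set_eqI)
  fix \<sigma> :: "nat \<Rightarrow> int"
  have "\<sigma> j \<in> (if k j = 0 then {1} else {1, -1}) \<longleftrightarrow> \<sigma> j \<in> {1, -1} \<and> (k j = 0 \<longrightarrow> \<sigma> j = 1)" for j
    by auto
  then show "\<sigma> \<in> signs_at d k \<longleftrightarrow> \<sigma> \<in> (\<Pi>\<^sub>E j\<in>{..<d}. if k j = 0 then {1} else {1, -1})"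
    unfolding signs_at_def signs_def PiE_iff by blast
qed

lemma finite_signs: "finite (signs d)"
  unfolding signs_def by (intro finite_PiE) auto

lemma finite_signs_at: "finite (signs_at d k)"
  unfolding signs_at_def using finite_signs by simp

lemma power_num_nonzero:
  fixes c :: "'a::comm_monoid_mult"
  shows "c ^ num_nonzero d k = (\<Prod>j<d. if k j = 0 then 1 else c)"
proof -
  have "(\<Prod>j<d. if k j = 0 then 1 else c) = (\<Prod>j\<in>{j. j < d \<and> k j \<noteq> 0}. c)"
    by (rule prod.mono_neutral_cong_right) auto
  then show ?thesis by (simp add: num_nonzero_def)
qed

lemma cis_sum: "cis (\<Sum>j\<in>A. a j) = (\<Prod>j\<in>A. cis (a j))"
  by (induction A rule: infinite_finite_induct) (simp_all flip: cis_mult)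

text \<open>
  Expanding \<open>\<Prod> 2 cos (a j) = \<Prod> (exp (i a j) + exp (- i a j))\<close> gives one character per choice of
  signs.  Coordinates with \<open>k j = 0\<close> admit only the sign \<open>+1\<close>, which is why \<open>a j\<close> must vanish there.
  Keeping the complex sum, although its value is real, later lets a single multiplication by a
  character shift every frequency at once.
\<close>

lemma sum_signs_at_cis:
  assumes "\<And>j. j < d \<Longrightarrow> k j = 0 \<Longrightarrow> a j = 0"
  shows "(\<Sum>\<sigma>\<in>signs_at d k. cis (\<Sum>j<d. real_of_int (\<sigma> j) * a j))
           = complex_of_real (2 ^ num_nonzero d k * (\<Prod>j<d. cos (a j)))"
proof -
  have "(\<Sum>\<sigma>\<in>signs_at d k. cis (\<Sum>j<d. real_of_int (\<sigma> j) * a j))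
      = (\<Prod>j<d. \<Sum>s\<in>(if k j = 0 then {1} else {1, -1}). cis (real_of_int s * a j))"
    unfolding signs_at_eq_PiE cis_sum by (subst prod_sum_PiE) auto
  also have "\<dots> = (\<Prod>j<d. complex_of_real ((if k j = 0 then 1 else 2) * cos (a j)))"
    using assms by (intro prod.cong) (auto simp: complex_eq_iff)
  also have "\<dots> = complex_of_real (2 ^ num_nonzero d k * (\<Prod>j<d. cos (a j)))"
    by (simp only: power_num_nonzero prod.distrib flip: of_real_prod)
  finally show ?thesis .
qed

section \<open>The lattice rule on tent-transformed basis functions\<close>

text \<open>
  The sum of the powers of an \<open>n\<close>-th root of unity; the root equals \<open>1\<close> exactly if \<open>n\<close> divides \<open>m\<close>.
\<close>

lemma sum_cis_multiples:
  fixes m :: int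
  assumes "n \<ge> 1"
  shows "(\<Sum>i<n. cis (2 * pi * (real i * real_of_int m / real n)))
           = (if int n dvd m then of_nat n else 0)"
proof -
  define w where "w = cis (2 * pi * (real_of_int m / real n))"
  have pow: "cis (2 * pi * (real i * real_of_int m / real n)) = w ^ i" for i
    unfolding w_def Complex.DeMoivre by (rule arg_cong[of _ _ cis]) (simp add: mult_ac)
  have "w ^ n = 1"
    using assms pow[of n] by (simp add: cis_multiple_2pi)
  have one: "w = 1 \<longleftrightarrow> int n dvd m"
  proof
    assume "w = 1"
    then have "cos (2 * pi * (real_of_int m / real n)) = 1"
      by (auto simp: w_def complex_eq_iff)
    then obtain q :: int where "2 * pi * (real_of_int m / real n) = of_int q * 2 * pi"
      using cos_one_2pi_int by blast
    then have "real_of_int m = real_of_int (q * int n)"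
      using assms by (simp add: field_simps)
    then have "m = q * int n" by linarith
    then show "int n dvd m" by simp
  next
    assume "int n dvd m"
    then obtain q where "m = int n * q" by blast
    then show "w = 1"
      using assms by (simp add: w_def cis_multiple_2pi)
  qed
  show ?thesis
  proof (cases "int n dvd m")
    case True
    then show ?thesis unfolding pow using one by simp
  next
    case False
    then have "w \<noteq> 1" using one by simp
    then show ?thesis unfolding pow using False \<open>w ^ n = 1\<close> by (simp add: sum_gp_strict)
  qed
qed

definition lattice_point :: "nat \<Rightarrow> nat \<Rightarrow> (nat \<Rightarrow> int) \<Rightarrow> nat \<Rightarrow> nat \<Rightarrow> real" where
  "lattice_point d n z i = (\<lambda>j\<in>{..<d}. real_of_int ((int i * z j) mod int n) / real n)"

lemma lattice_rule_eq:
  "lattice_rule d n z g = (1 / real n) * (\<Sum>i<n. g (lattice_point d n z i))"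
  by (simp add: lattice_rule_def lattice_point_def)

lemma lattice_point_in_unit_interval:
  assumes "n \<ge> 1" "j < d"
  shows "lattice_point d n z i j \<in> {0..1}"
proof -
  have "0 \<le> (int i * z j) mod int n" "(int i * z j) mod int n < int n"
    using assms by auto
  then have "0 \<le> real_of_int ((int i * z j) mod int n)"
    "real_of_int ((int i * z j) mod int n) \<le> real n" by linarith+
  then show ?thesis using assms by (simp add: lattice_point_def)
qed

lemma tent_in_unit_cube:
  assumes "\<And>j. j < d \<Longrightarrow> x j \<in> {0..1}"
  shows "tent d x \<in> unit_cube d"
proof -
  have "1 - \<bar>2 * x j - 1\<bar> \<in> {0..1}" if "j < d" for j
    using assms[OF that] by (simp add: abs_le_iff)
  then show ?thesis unfolding unit_cube_def tent_def by (intro restrict_PiE_iff[THEN iffD2]) simp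
qed

text \<open>
  Reducing \<open>i * z j\<close> modulo \<open>n\<close> shifts the point by an integer vector, to which a character with
  integer frequency is blind.
\<close>

lemma cis_dot_lattice_point:
  fixes h :: "nat \<Rightarrow> int"
  assumes "n \<ge> 1"
  shows "cis (2 * pi * (\<Sum>j<d. real_of_int (h j) * lattice_point d n z i j))
           = cis (2 * pi * (real i * real_of_int (dot d h z) / real n))"
proof -
  define q where "q j = (int i * z j) div int n" for j
  have pt: "lattice_point d n z i j = real i * real_of_int (z j) / real n - real_of_int (q j)"
    if "j < d" for j
  proof -
    have "int i * z j = (int i * z j) mod int n + int n * q j"
      by (simp add: q_def)
    then have "real i * real_of_int (z j)
        = real_of_int ((int i * z j) mod int n) + real n * real_of_int (q j)"
      by (metis of_int_add of_int_mult of_int_of_nat_eq)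
    then show ?thesis using that assms by (simp add: lattice_point_def field_simps)
  qed
  have "(\<Sum>j<d. real_of_int (h j) * lattice_point d n z i j)
      = (\<Sum>j<d. real i * real_of_int (h j * z j) / real n - real_of_int (h j * q j))"
    by (intro sum.cong) (auto simp: pt algebra_simps)
  also have "\<dots> = real i * real_of_int (dot d h z) / real n - real_of_int (\<Sum>j<d. h j * q j)"
    by (simp add: sum_subtractf dot_def sum_distrib_left sum_divide_distrib)
  finally have "cis (2 * pi * (\<Sum>j<d. real_of_int (h j) * lattice_point d n z i j))
      = cis (2 * pi * (real i * real_of_int (dot d h z) / real n)
             - 2 * pi * real_of_int (\<Sum>j<d. h j * q j))"
    by (simp only: right_diff_distrib)
  also have "\<dots> = cis (2 * pi * (real i * real_of_int (dot d h z) / real n))"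
    by (simp only: cis_multiple_2pi Ints_of_int div_by_1 flip: cis_divide)
  finally show ?thesis .
qed

text \<open>
  On the right half of the interval the tent value is \<open>2 - 2 x\<close>, and the cosine is even and
  \<open>2 \<pi>\<close>-periodic; integrality of the frequency enters here.
\<close>

lemma cos_tent:
  assumes "x \<in> {0..1}"
  shows "cos (pi * real m * (1 - \<bar>2 * x - 1\<bar>)) = cos (2 * pi * real m * x)"
proof (cases "x \<le> 1 / 2")
  case True
  then have "1 - \<bar>2 * x - 1\<bar> = 2 * x" by auto
  then show ?thesis by (simp add: mult_ac)
next
  case False
  then have "1 - \<bar>2 * x - 1\<bar> = 2 - 2 * x" by auto
  then have "cos (pi * real m * (1 - \<bar>2 * x - 1\<bar>))
      = cos (2 * pi * real m - 2 * pi * real m * x)"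
    by (simp add: algebra_simps)
  also have "\<dots> = cos (2 * pi * real m * x)"
    using cos_int_2pin[of "int m"] sin_int_2pin[of "int m"]
    by (simp add: cos_diff mult_ac)
  finally show ?thesis .
qed

text \<open>
  This is the quantity \<open>c\<^bsub>k\<^esub>\<close> of the reconstruction formula, but with the sign changes applied to a
  second index \<open>k'\<close>.  Its vanishing for \<open>k' \<noteq> k\<close> is the reconstruction condition.
\<close>

definition alias_count ::
    "nat \<Rightarrow> nat \<Rightarrow> (nat \<Rightarrow> int) \<Rightarrow> (nat \<Rightarrow> nat) \<Rightarrow> (nat \<Rightarrow> nat) \<Rightarrow> nat" where
  "alias_count d n z k' k =
     card {\<sigma> \<in> signs_at d k'. [dot d (flip d \<sigma> k') z = dot d (int \<circ> k) z] (mod int n)}"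

lemma multiplicity_c_eq: "multiplicity_c d n z k = alias_count d n z k k"
  by (simp add: multiplicity_c_def alias_count_def)

lemma alias_count_eq_0_iff:
  "alias_count d n z k' k = 0 \<longleftrightarrow>
     (\<forall>\<sigma>\<in>signs_at d k'. \<not> [dot d (flip d \<sigma> k') z = dot d (int \<circ> k) z] (mod int n))"
  by (auto simp: alias_count_def finite_signs_at)

text \<open>
  The all-plus sign vector always counts, so the division by \<open>c\<^bsub>k\<^esub>\<close> is legitimate.
\<close>

lemma alias_count_self_pos: "alias_count d n z k k > 0"
proof -
  have "(\<lambda>j\<in>{..<d}. 1) \<in> signs_at d k" by (auto simp: signs_at_def signs_def)
  moreover have "dot d (flip d (\<lambda>j\<in>{..<d}. 1) k) z = dot d (int \<circ> k) z"
    by (simp add: dot_def flip_def)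
  ultimately have "alias_count d n z k k \<noteq> 0"
    unfolding alias_count_eq_0_iff by (metis cong_refl)
  then show ?thesis by simp
qed

text \<open>
  At each node the transformed basis function is a real number \<open>P i\<close> up to scaling, and it is also a
  sum of characters with frequencies \<open>\<sigma>(k')\<close>.  As \<open>P i\<close> is real, the factor \<open>cos (2 \<pi> k \<cdot> x)\<close> may be
  replaced by \<open>exp (- 2 \<pi> i k \<cdot> x)\<close> under the real part.  This yields the frequencies \<open>\<sigma>(k') - k\<close> only,
  without the companions \<open>\<sigma>(k') + k\<close> of a product-to-sum formula.
\<close>

lemma lattice_rule_cos_basis_tent:
  assumes "n \<ge> 1"
  shows "lattice_rule d n z
           (\<lambda>x. cos_basis d k' (tent d x) * (sqrt 2 ^ num_nonzero d k * cos (2 * pi * dot d (real \<circ> k) x)))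
         = sqrt 2 ^ num_nonzero d k / sqrt 2 ^ num_nonzero d k' * real (alias_count d n z k' k)"
proof -
  define w where "w i = cis (2 * pi * (real i * real_of_int (dot d (int \<circ> k) z) / real n))" for i
  define P where "P i = 2 ^ num_nonzero d k' *
    (\<Prod>j<d. cos (2 * pi * real (k' j) * lattice_point d n z i j))" for i
  have basis: "cos_basis d k' (tent d (lattice_point d n z i)) = P i / sqrt 2 ^ num_nonzero d k'" for i
  proof -
    have "(\<Prod>j<d. cos (pi * real (k' j) * tent d (lattice_point d n z i) j))
        = (\<Prod>j<d. cos (2 * pi * real (k' j) * lattice_point d n z i j))"
      using cos_tent[OF lattice_point_in_unit_interval[OF assms]]
      by (intro prod.cong) (auto simp: tent_def)
    moreover have "(2::real) ^ num_nonzero d k' = sqrt 2 ^ num_nonzero d k' * sqrt 2 ^ num_nonzero d k'"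
      by (simp flip: power_mult_distrib)
    ultimately show ?thesis by (simp add: cos_basis_def P_def)
  qed
  have cos_k: "cos (2 * pi * dot d (real \<circ> k) (lattice_point d n z i)) = Re (cnj (w i))" for i
    using arg_cong[OF cis_dot_lattice_point[OF assms, of "int \<circ> k" d z i], of Re]
    by (simp add: w_def dot_def)
  have P_cis: "complex_of_real (P i) = (\<Sum>\<sigma>\<in>signs_at d k'.
      cis (2 * pi * (real i * real_of_int (dot d (flip d \<sigma> k') z) / real n)))" for i
  proof -
    have "complex_of_real (P i) = (\<Sum>\<sigma>\<in>signs_at d k'.
        cis (\<Sum>j<d. real_of_int (\<sigma> j) * (2 * pi * real (k' j) * lattice_point d n z i j)))"
      unfolding P_def by (rule sum_signs_at_cis[symmetric]) simp
    also have "\<dots> = (\<Sum>\<sigma>\<in>signs_at d k'.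
        cis (2 * pi * (\<Sum>j<d. real_of_int (flip d \<sigma> k' j) * lattice_point d n z i j)))"
      by (intro sum.cong refl arg_cong[of _ _ cis])
        (simp add: sum_distrib_left flip_def mult_ac)
    finally show ?thesis by (simp only: cis_dot_lattice_point[OF assms])
  qed
  have "(\<Sum>i<n. P i * Re (cnj (w i))) = Re (\<Sum>i<n. complex_of_real (P i) * cnj (w i))"
    by simp
  also have "(\<Sum>i<n. complex_of_real (P i) * cnj (w i)) = (\<Sum>i<n. \<Sum>\<sigma>\<in>signs_at d k'.
      cis (2 * pi * (real i * real_of_int (dot d (flip d \<sigma> k') z - dot d (int \<circ> k) z) / real n)))"
    unfolding P_cis sum_distrib_right w_def cis_cnj cis_mult
    by (intro sum.cong refl arg_cong[of _ _ cis]) (simp add: algebra_simps diff_divide_distrib)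
  also have "\<dots> = (\<Sum>\<sigma>\<in>signs_at d k'.
      if int n dvd dot d (flip d \<sigma> k') z - dot d (int \<circ> k) z then of_nat n else 0)"
    by (subst sum.swap) (simp only: sum_cis_multiples[OF assms])
  also have "\<dots> = of_nat n * of_nat (alias_count d n z k' k)"
    by (simp add: alias_count_def cong_iff_dvd_diff finite_signs_at mult_ac flip: sum.inter_filter)
  finally have sum_P: "(\<Sum>i<n. P i * Re (cnj (w i))) = real n * real (alias_count d n z k' k)"
    by simp
  have "lattice_rule d n z
      (\<lambda>x. cos_basis d k' (tent d x) * (sqrt 2 ^ num_nonzero d k * cos (2 * pi * dot d (real \<circ> k) x)))
    = sqrt 2 ^ num_nonzero d k / sqrt 2 ^ num_nonzero d k' / real n * (\<Sum>i<n. P i * Re (cnj (w i)))"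
    unfolding lattice_rule_eq basis cos_k sum_distrib_left
    by (intro sum.cong refl) (simp add: mult_ac)
  then show ?thesis unfolding sum_P using assms by simp
qed

text \<open>
  Only the values of \<open>f\<close> on the unit cube matter, because the tent transform maps lattice points
  into it.
\<close>

lemma lattice_coeff_expansion:
  assumes "n \<ge> 1" and f: "\<And>x. x \<in> unit_cube d \<Longrightarrow> f x = (\<Sum>k'\<in>\<Lambda>. a k' * cos_basis d k' x)"
  shows "lattice_coeff d n z f k =
    (\<Sum>k'\<in>\<Lambda>. a k' * (sqrt 2 ^ num_nonzero d k / sqrt 2 ^ num_nonzero d k' *
        real (alias_count d n z k' k))) / real (alias_count d n z k k)"
proof -
  define g where "g x = sqrt 2 ^ num_nonzero d k * cos (2 * pi * dot d (real \<circ> k) x)" for x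
  have "f (tent d (lattice_point d n z i)) =
      (\<Sum>k'\<in>\<Lambda>. a k' * cos_basis d k' (tent d (lattice_point d n z i)))" for i
    by (intro f tent_in_unit_cube lattice_point_in_unit_interval assms)
  then have "lattice_rule d n z (\<lambda>x. f (tent d x) * g x)
      = (1 / real n) * (\<Sum>i<n. \<Sum>k'\<in>\<Lambda>.
          a k' * (cos_basis d k' (tent d (lattice_point d n z i)) * g (lattice_point d n z i)))"
    by (simp add: lattice_rule_eq sum_distrib_right mult.assoc)
  also have "\<dots> = (\<Sum>k'\<in>\<Lambda>. a k' * lattice_rule d n z (\<lambda>x. cos_basis d k' (tent d x) * g x))"
    by (subst sum.swap) (simp add: lattice_rule_eq sum_distrib_left mult_ac)
  finally show ?thesis
    by (simp add: lattice_coeff_def multiplicity_c_eq g_def lattice_rule_cos_basis_tent[OF assms(1)])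
qed

section \<open>Orthonormality of the cosine basis\<close>

lemma has_bochner_integral_cos_int_unit:
  fixes m :: int
  shows "has_bochner_integral lborel (\<lambda>x. cos (pi * real_of_int m * x) * indicator {0..1} x)
           (if m = 0 then 1 else 0)"
proof (cases "m = 0")
  case True
  then show ?thesis
    using has_bochner_integral_FTC_Icc_real[of 0 1 "\<lambda>x. x" "\<lambda>x. 1"] by simp
next
  case False
  have "has_bochner_integral lborel (\<lambda>x. cos (pi * real_of_int m * x) * indicator {0..1} x)
      (sin (pi * real_of_int m * 1) / (pi * real_of_int m)
       - sin (pi * real_of_int m * 0) / (pi * real_of_int m))"
    using False
    by (intro has_bochner_integral_FTC_Icc_real)
      (auto intro!: derivative_eq_intros continuous_intros simp: field_simps)
  moreover have "sin (pi * real_of_int m) = 0"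
    by (metis mult.commute sin_zero_iff_int2)
  ultimately show ?thesis using False by simp
qed

lemma has_bochner_integral_cos_cos_unit:
  "has_bochner_integral lborel
     (\<lambda>x. indicator {0..1} x * (cos (pi * real a * x) * cos (pi * real b * x)))
     (if a \<noteq> b then 0 else if a = 0 then 1 else 1 / 2)"
proof -
  have "has_bochner_integral lborel
      (\<lambda>x. (cos (pi * real_of_int (int a - int b) * x) * indicator {0..1} x
          + cos (pi * real_of_int (int a + int b) * x) * indicator {0..1} x) / 2)
      (((if int a - int b = 0 then 1 else 0) + (if int a + int b = 0 then 1 else 0)) / 2)"
    by (intro has_bochner_integral_divide_zero has_bochner_integral_add
        has_bochner_integral_cos_int_unit)
  moreover have "(cos (pi * real_of_int (int a - int b) * x) * indicator {0..1} x
          + cos (pi * real_of_int (int a + int b) * x) * indicator {0..1} x) / 2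
      = indicator {0..1} x * (cos (pi * real a * x) * cos (pi * real b * x))" for x :: real
    by (simp add: cos_times_cos algebra_simps)
  moreover have "((if int a - int b = 0 then 1 else 0) + (if int a + int b = 0 then 1 else 0)) / 2
      = (if a \<noteq> b then 0 else if a = 0 then 1 else 1 / 2 :: real)"
    by auto
  ultimately show ?thesis by simp
qed

text \<open>
  The integral over the cube factors into one-dimensional integrals.  A coordinate in which \<open>k\<close> and
  \<open>k'\<close> differ contributes a factor \<open>0\<close>.  For \<open>k = k'\<close> each nonzero coordinate contributes \<open>1 / 2\<close>, which
  the normalisation \<open>2 ^ num_nonzero d k\<close> compensates.
\<close>

lemma cos_coeff_cos_basis:
  assumes "k \<in> {..<d} \<rightarrow>\<^sub>E UNIV" "k' \<in> {..<d} \<rightarrow>\<^sub>E UNIV"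
  shows "cos_coeff d (cos_basis d k') k = (if k = k' then 1 else 0)"
proof -
  interpret product_sigma_finite "\<lambda>_::nat. lborel :: real measure" ..
  define g where "g j x = indicator {0..1} x * (cos (pi * real (k' j) * x) * cos (pi * real (k j) * x))"
    for j and x :: real
  define c where "c = sqrt 2 ^ num_nonzero d k' * sqrt 2 ^ num_nonzero d k"
  have "cos_coeff d (cos_basis d k') k
      = (\<integral>x. c * (\<Prod>j<d. g j (x j)) \<partial>(PiM {..<d} (\<lambda>_. lborel)))"
    unfolding cos_coeff_def set_lebesgue_integral_def
  proof (intro Bochner_Integration.integral_cong refl)
    fix x :: "nat \<Rightarrow> real"
    assume "x \<in> space (PiM {..<d} (\<lambda>_. lborel))"
    then have "x \<in> extensional {..<d}" by (simp add: space_PiM PiE_def)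
    then have "(indicator (unit_cube d) x :: real) = (\<Prod>j<d. indicator {0..1} (x j))"
      by (auto simp: unit_cube_def PiE_iff indicator_def)
    then show "indicat_real (unit_cube d) x *\<^sub>R (cos_basis d k' x * cos_basis d k x)
        = c * (\<Prod>j<d. g j (x j))"
      by (simp add: cos_basis_def g_def c_def prod.distrib)
  qed
  also have "\<dots> = c * (\<Prod>j<d. if k' j \<noteq> k j then 0 else if k' j = 0 then 1 else 1 / 2)"
    unfolding g_def
    using has_bochner_integral_cos_cos_unit
    by (subst integral_mult_right_zero, subst product_integral_prod)
      (auto simp: has_bochner_integral_iff)
  also have "\<dots> = (if k = k' then 1 else 0)"
  proof (cases "k = k'")
    case True
    then have "c = 2 ^ num_nonzero d k" by (simp add: c_def flip: power_mult_distrib)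
    then show ?thesis using True
      by (simp add: power_one_over flip: power_num_nonzero)
  next
    case False
    then obtain j where "j < d" "k' j \<noteq> k j"
      using assms by (metis PiE_ext lessThan_iff)
    then have "(\<Prod>j<d. if k' j \<noteq> k j then 0 else if k' j = 0 then 1 else 1 / 2) = (0::real)"
      by (intro prod_zero bexI[of _ j]) auto
    then show ?thesis using False by simp
  qed
  finally show ?thesis .
qed

lemma cos_basis_in_cos_space:
  assumes "finite \<Lambda>" "\<Lambda> \<subseteq> {..<d} \<rightarrow>\<^sub>E UNIV" "k' \<in> \<Lambda>"
  shows "cos_basis d k' \<in> cos_space d \<Lambda>"
proof -
  have "cos_coeff d (cos_basis d k') k = (if k = k' then 1 else 0)" if "k \<in> \<Lambda>" for k
    using that assms by (intro cos_coeff_cos_basis) auto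
  then have "(\<Sum>k\<in>\<Lambda>. cos_coeff d (cos_basis d k') k * cos_basis d k x) = cos_basis d k' x" for x
    using assms by (simp add: if_distrib[of "\<lambda>t. t * _"] cong: if_cong)
  then show ?thesis by (simp add: cos_space_def)
qed

section \<open>Exact reconstruction\<close>

lemma reconstructs_iff:
  assumes "finite \<Lambda>" "\<Lambda> \<subseteq> {..<d} \<rightarrow>\<^sub>E UNIV" "n \<ge> 1"
  shows "reconstructs d n z \<Lambda> \<longleftrightarrow> reconstruction_condition d n z \<Lambda>"
proof
  assume rec: "reconstructs d n z \<Lambda>"
  have "alias_count d n z k' k = 0" if "k \<in> \<Lambda>" "k' \<in> \<Lambda>" "k \<noteq> k'" for k k'
  proof -
    have "0 = cos_coeff d (cos_basis d k') k"
      using that assms cos_coeff_cos_basis[of k d k'] by auto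
    also have "\<dots> = lattice_coeff d n z (cos_basis d k') k"
      using rec that cos_basis_in_cos_space[OF assms(1,2)] by (auto simp: reconstructs_def)
    also have "\<dots> = sqrt 2 ^ num_nonzero d k / sqrt 2 ^ num_nonzero d k' *
        real (alias_count d n z k' k) / real (alias_count d n z k k)"
      using lattice_coeff_expansion[OF assms(3), where \<Lambda> = "{k'}" and a = "\<lambda>_. 1" and f = "cos_basis d k'" and d = d]
      by simp
    finally show ?thesis using alias_count_self_pos[of d n z k] by simp
  qed
  then show "reconstruction_condition d n z \<Lambda>"
    by (simp add: reconstruction_condition_def alias_count_eq_0_iff)
next
  assume cond: "reconstruction_condition d n z \<Lambda>"
  show "reconstructs d n z \<Lambda>"
    unfolding reconstructs_def
  proof (intro ballI)
    fix f k
    assume f: "f \<in> cos_space d \<Lambda>" and k: "k \<in> \<Lambda>"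
    have "lattice_coeff d n z f k =
        (\<Sum>k'\<in>\<Lambda>. cos_coeff d f k' * (sqrt 2 ^ num_nonzero d k / sqrt 2 ^ num_nonzero d k' *
          real (alias_count d n z k' k))) / real (alias_count d n z k k)"
      using f by (intro lattice_coeff_expansion assms) (auto simp: cos_space_def)
    also have "(\<Sum>k'\<in>\<Lambda>. cos_coeff d f k' * (sqrt 2 ^ num_nonzero d k / sqrt 2 ^ num_nonzero d k' *
          real (alias_count d n z k' k)))
        = (\<Sum>k'\<in>\<Lambda>. if k' = k then cos_coeff d f k * real (alias_count d n z k k) else 0)"
    proof (intro sum.cong refl)
      fix k' assume "k' \<in> \<Lambda>"
      then have "k' \<noteq> k \<Longrightarrow> alias_count d n z k' k = 0"
        using cond k by (auto simp: reconstruction_condition_def alias_count_eq_0_iff)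
      then show "cos_coeff d f k' * (sqrt 2 ^ num_nonzero d k / sqrt 2 ^ num_nonzero d k' *
          real (alias_count d n z k' k))
        = (if k' = k then cos_coeff d f k * real (alias_count d n z k k) else 0)"
        by auto
    qed
    also have "\<dots> = cos_coeff d f k * real (alias_count d n z k k)"
      using k assms by simp
    finally show "cos_coeff d f k = lattice_coeff d n z f k"
      using alias_count_self_pos[of d n z k] by simp
  qed
qed

section \<open>Component-by-component construction\<close>

lemma dot_cong:
  "(\<And>j. j < d \<Longrightarrow> a j = a' j) \<Longrightarrow> (\<And>j. j < d \<Longrightarrow> b j = b' j) \<Longrightarrow> dot d a b = dot d a' b'"
  by (simp add: dot_def)

lemma dot_Suc_update: "dot (Suc s) a (z(s := c)) = dot s a z + a s * c"
  by (simp add: dot_def)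

lemma reconstruction_condition_cong:
  assumes "\<And>j. j < s \<Longrightarrow> z j = z' j"
  shows "reconstruction_condition s n z \<Lambda> \<longleftrightarrow> reconstruction_condition s n z' \<Lambda>"
proof -
  have "dot s a z = dot s a z'" for a using assms by (intro dot_cong) auto
  then show ?thesis by (simp add: reconstruction_condition_def)
qed

lemma finite_mirrored:
  assumes "finite \<Lambda>"
  shows "finite (mirrored d \<Lambda>)"
proof -
  have "mirrored d \<Lambda> = (\<lambda>(\<sigma>, k). flip d \<sigma> k) ` (signs d \<times> \<Lambda>)"
    by (auto simp: mirrored_def)
  then show ?thesis using assms finite_signs by simp
qed

lemma card_initial_indices_le: "finite \<Lambda> \<Longrightarrow> card (initial_indices s \<Lambda>) \<le> card \<Lambda>"
  by (simp add: initial_indices_def card_image_le)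

text \<open>
  Every mirrored vector of the projected index set is the projection of a mirrored vector: extend
  the signs by \<open>+1\<close>.
\<close>

lemma card_mirrored_initial_indices_le:
  assumes "finite \<Lambda>" "s \<le> d"
  shows "card (mirrored s (initial_indices s \<Lambda>)) \<le> card (mirrored d \<Lambda>)"
proof -
  have "mirrored s (initial_indices s \<Lambda>) \<subseteq> (\<lambda>h. restrict h {..<s}) ` mirrored d \<Lambda>"
  proof
    fix h assume "h \<in> mirrored s (initial_indices s \<Lambda>)"
    then obtain \<sigma> k where h: "h = flip s \<sigma> (restrict k {..<s})" and "k \<in> \<Lambda>" "\<sigma> \<in> signs s"
      by (auto simp: mirrored_def initial_indices_def)
    define \<tau> where "\<tau> = (\<lambda>j\<in>{..<d}. if j < s then \<sigma> j else 1)"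
    have "\<tau> \<in> signs d"
      using \<open>\<sigma> \<in> signs s\<close> by (auto simp: signs_def \<tau>_def PiE_iff)
    then have "flip d \<tau> k \<in> mirrored d \<Lambda>"
      using \<open>k \<in> \<Lambda>\<close> by (auto simp: mirrored_def)
    moreover have "h = restrict (flip d \<tau> k) {..<s}"
      using assms by (auto simp: h flip_def \<tau>_def fun_eq_iff)
    ultimately show "h \<in> (\<lambda>h. restrict h {..<s}) ` mirrored d \<Lambda>" by blast
  qed
  then show ?thesis
    using finite_mirrored[OF assms(1)] by (meson card_image_le card_mono finite_imageI order_trans)
qed

lemma component_le_max_component:
  assumes "finite \<Lambda>" "k \<in> \<Lambda>" "j < d"
  shows "k j \<le> max_component d \<Lambda>"
proof -
  have "{k j | k j. k \<in> \<Lambda> \<and> j < d} = (\<lambda>(k, j). k j) ` (\<Lambda> \<times> {..<d})" by auto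
  then have "finite {k j | k j. k \<in> \<Lambda> \<and> j < d}" using assms by simp
  then show ?thesis unfolding max_component_def using assms by (intro Max_ge) auto
qed

lemma card_le_if_at_most_one_each:
  assumes "finite P" "\<And>p c c'. p \<in> P \<Longrightarrow> R p c \<Longrightarrow> R p c' \<Longrightarrow> c = c'"
  shows "card {c. \<exists>p\<in>P. R p c} \<le> card P"
proof -
  have "{c. \<exists>p\<in>P. R p c} \<subseteq> (\<lambda>p. SOME c. R p c) ` P"
  proof
    fix c assume "c \<in> {c. \<exists>p\<in>P. R p c}"
    then obtain p where p: "p \<in> P" "R p c" by blast
    then have "R p (SOME c. R p c)" by (metis someI)
    with p assms(2) have "c = (SOME c. R p c)" by blast
    with p show "c \<in> (\<lambda>p. SOME c. R p c) ` P" by blast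
  qed
  then show ?thesis using assms(1) by (meson card_image_le card_mono finite_imageI order_trans)
qed

text \<open>
  Subtracting the two congruences leaves \<open>(h - k) * (c - c') \<equiv> 0\<close>, and \<open>h - k\<close> is a nonzero integer
  too small to be divisible by \<open>n\<close>.
\<close>

lemma component_determined_mod_prime:
  fixes h k x y c c' :: int
  assumes "prime n" "\<bar>h - k\<bar> < int n" "h \<noteq> k"
    and "c \<in> {1..int n - 1}" "c' \<in> {1..int n - 1}"
    and "[x + h * c = y + k * c] (mod int n)" "[x + h * c' = y + k * c'] (mod int n)"
  shows "c = c'"
proof -
  have "int n dvd (x + h * c - (y + k * c)) - (x + h * c' - (y + k * c'))"
    using assms(6,7) unfolding cong_iff_dvd_diff by (rule dvd_diff)
  also have "(x + h * c - (y + k * c)) - (x + h * c' - (y + k * c')) = (h - k) * (c - c')"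
    by (simp add: algebra_simps)
  finally have "int n dvd h - k \<or> int n dvd c - c'"
    using assms(1) by (simp add: prime_dvd_mult_iff)
  moreover have "\<not> int n dvd h - k"
    using assms(2,3) zdvd_not_zless[of "\<bar>h - k\<bar>" "int n"] by auto
  ultimately have "int n dvd c - c'" by simp
  then show ?thesis
    using assms(4,5) zdvd_not_zless[of "\<bar>c - c'\<bar>" "int n"] by fastforce
qed

text \<open>
  A value \<open>c\<close> of the new component can fail only through a pair of \<open>k\<close> and \<open>h = \<sigma>(k')\<close> whose last
  components differ, and each such pair spoils at most one value.
\<close>

lemma reconstruction_condition_extend:
  assumes "finite \<Lambda>" "prime n" "s < d"
    and card: "card \<Lambda> * card (mirrored d \<Lambda>) < n" and max: "2 * max_component d \<Lambda> < n"
    and cond: "reconstruction_condition s n z (initial_indices s \<Lambda>)"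
  shows "\<exists>c \<in> {1..int n - 1}.
           reconstruction_condition (Suc s) n (z(s := c)) (initial_indices (Suc s) \<Lambda>)"
proof -
  define L where "L = initial_indices (Suc s) \<Lambda>"
  define M where "M = mirrored (Suc s) L"
  define \<iota> where "\<iota> k = (\<lambda>j\<in>{..<Suc s}. int (k j))" for k :: "nat \<Rightarrow> nat"
  \<comment> \<open>Removing \<open>\<iota> k\<close>, which is \<open>k\<close> read as an integer vector, saves the \<open>card L\<close> pairs that bring the
    count below \<open>n - 1\<close>; without this saving it could equal \<open>n - 1\<close>.\<close>
  define P where "P = (SIGMA k:L. M - {\<iota> k})"
  define bad where "bad p c \<longleftrightarrow> c \<in> {1..int n - 1} \<and> snd p s \<noteq> int (fst p s) \<and>
      [dot s (snd p) z + snd p s * c = dot s (int \<circ> fst p) z + int (fst p s) * c] (mod int n)"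
    for p :: "(nat \<Rightarrow> nat) \<times> (nat \<Rightarrow> int)" and c
  have finL: "finite L" using assms(1) by (simp add: L_def initial_indices_def)
  have finM: "finite M" using finL by (simp add: M_def finite_mirrored)
  have finP: "finite P" using finL finM by (simp add: P_def)
  have bound: "2 * k s < n" if "k \<in> L" for k
    using that max component_le_max_component[OF assms(1) _ \<open>s < d\<close>]
    by (fastforce simp: L_def initial_indices_def)
  have \<iota>M: "\<iota> k \<in> M" if "k \<in> L" for k
  proof -
    have "\<iota> k = flip (Suc s) (\<lambda>j\<in>{..<Suc s}. 1) k" by (auto simp: \<iota>_def flip_def)
    moreover have "(\<lambda>j\<in>{..<Suc s}. 1) \<in> signs (Suc s)" by (auto simp: signs_def)
    ultimately show ?thesis using that by (auto simp: M_def mirrored_def)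
  qed
  have "card P = card L * (card M - 1)"
    using finL finM \<iota>M by (simp add: P_def card_SigmaI)
  also have "\<dots> \<le> card \<Lambda> * (card (mirrored d \<Lambda>) - 1)"
    unfolding M_def L_def using assms
    by (intro mult_le_mono card_initial_indices_le diff_le_mono card_mirrored_initial_indices_le) auto
  also have "\<dots> < n - 1"
  proof (cases "card \<Lambda> * (card (mirrored d \<Lambda>) - 1) = 0")
    case True
    then show ?thesis unfolding True using prime_gt_1_nat[OF assms(2)] by linarith
  next
    case False
    then have "card \<Lambda> * (card (mirrored d \<Lambda>) - 1) < card \<Lambda> * card (mirrored d \<Lambda>)"
      by simp
    then show ?thesis using card by linarith
  qed
  finally have cardP: "card P < n - 1" .
  have unique: "c = c'" if p: "p \<in> P" and c: "bad p c" "bad p c'" for p c c'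
  proof -
    obtain k h where p_eq: "p = (k, h)" and k: "k \<in> L" and "h \<in> M"
      using p by (cases p) (auto simp: P_def)
    then obtain \<sigma> k' where h: "h = flip (Suc s) \<sigma> k'" and "k' \<in> L" "\<sigma> \<in> signs (Suc s)"
      by (auto simp: M_def mirrored_def)
    then have "\<sigma> s = 1 \<or> \<sigma> s = - 1" by (auto simp: signs_def PiE_iff)
    then have "\<bar>h s\<bar> = int (k' s)" by (auto simp: h flip_def)
    then have "\<bar>h s - int (k s)\<bar> < int n"
      using bound[OF k] bound[OF \<open>k' \<in> L\<close>] by linarith
    then show ?thesis
      using c component_determined_mod_prime[OF assms(2)] unfolding bad_def p_eq by auto
  qed
  have "card {c. \<exists>p\<in>P. bad p c} \<le> card P"
    using finP unique by (rule card_le_if_at_most_one_each)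
  then have "card {c. \<exists>p\<in>P. bad p c} < card {1..int n - 1}" using cardP by simp
  moreover have "finite {c. \<exists>p\<in>P. bad p c}"
    by (rule finite_subset[of _ "{1..int n - 1}"]) (auto simp: bad_def)
  ultimately have "\<not> {1..int n - 1} \<subseteq> {c. \<exists>p\<in>P. bad p c}"
    using card_mono leD by blast
  then obtain c where c: "c \<in> {1..int n - 1}" "\<not> (\<exists>p\<in>P. bad p c)" by blast
  have "reconstruction_condition (Suc s) n (z(s := c)) L"
    unfolding reconstruction_condition_def
  proof (intro ballI impI notI)
    fix k k' \<sigma>
    assume k: "k \<in> L" and k': "k' \<in> L" and \<sigma>: "\<sigma> \<in> signs_at (Suc s) k'" and ne: "k \<noteq> k'"
      and "[dot (Suc s) (flip (Suc s) \<sigma> k') (z(s := c)) = dot (Suc s) (int \<circ> k) (z(s := c))] (mod int n)"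
    then have eq: "[dot s (flip (Suc s) \<sigma> k') z + flip (Suc s) \<sigma> k' s * c
        = dot s (int \<circ> k) z + int (k s) * c] (mod int n)"
      by (simp add: dot_Suc_update)
    have \<sigma>s: "\<sigma> s = 1 \<or> \<sigma> s = - 1" using \<sigma> by (auto simp: signs_at_def signs_def PiE_iff)
    show False
    proof (cases "flip (Suc s) \<sigma> k' s = int (k s)")
      case False
      then have "bad (k, flip (Suc s) \<sigma> k') c"
        using c(1) eq by (simp add: bad_def)
      moreover have "flip (Suc s) \<sigma> k' \<in> M"
        using \<sigma> k' by (auto simp: M_def mirrored_def signs_at_def)
      moreover have "flip (Suc s) \<sigma> k' \<noteq> \<iota> k"
        using False by (auto simp: \<iota>_def)
      ultimately show False using c(2) k by (auto simp: P_def)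
    next
      case True
      \<comment> \<open>Both components are nonnegative, so the sign is \<open>+1\<close> or they vanish.  The projections to
        dimension \<open>s\<close> must then differ, and the condition already established there applies.\<close>
      then have "k' s = k s" using \<sigma>s by (auto simp: flip_def)
      define r where "r = (\<lambda>k::nat \<Rightarrow> nat. restrict k {..<s})"
      have r_in: "r k \<in> initial_indices s \<Lambda>" if kL: "k \<in> L" for k
      proof -
        obtain l where "l \<in> \<Lambda>" "k = restrict l {..<Suc s}"
          using kL unfolding L_def initial_indices_def by blast
        then have "r k = restrict l {..<s}" by (auto simp: r_def fun_eq_iff)
        then show ?thesis using \<open>l \<in> \<Lambda>\<close> by (auto simp: initial_indices_def)
      qed
      have "r k \<noteq> r k'"
      proof
        assume "r k = r k'"
        then have "k j = k' j" if "j < Suc s" for j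
          using that \<open>k' s = k s\<close> unfolding r_def
          by (metis lessThan_iff less_Suc_eq restrict_apply')
        moreover have "k \<in> extensional {..<Suc s}" "k' \<in> extensional {..<Suc s}"
          using k k' by (auto simp: L_def initial_indices_def)
        ultimately show False using ne by (metis extensionalityI lessThan_iff)
      qed
      have "restrict \<sigma> {..<s} \<in> signs_at s (r k')"
        using \<sigma> by (auto simp: signs_at_def signs_def r_def PiE_iff)
      then have "\<not> [dot s (flip s (restrict \<sigma> {..<s}) (r k')) z = dot s (int \<circ> r k) z] (mod int n)"
        using cond r_in[OF k] r_in[OF k'] \<open>r k \<noteq> r k'\<close>
        unfolding reconstruction_condition_def by blast
      moreover have "dot s (flip s (restrict \<sigma> {..<s}) (r k')) z = dot s (flip (Suc s) \<sigma> k') z"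
        by (intro dot_cong) (auto simp: flip_def r_def)
      moreover have "dot s (int \<circ> r k) z = dot s (int \<circ> k) z"
        by (intro dot_cong) (auto simp: r_def)
      ultimately show False using eq True by (simp add: cong_add_rcancel)
    qed
  qed
  then show ?thesis using c(1) unfolding L_def by blast
qed

text \<open>
  In dimension \<open>0\<close> there is only one index vector, hence no pair to separate.
\<close>

lemma reconstruction_condition_0: "reconstruction_condition 0 n z (initial_indices 0 \<Lambda>)"
  by (auto simp: reconstruction_condition_def initial_indices_def)

lemma initial_indices_full:
  assumes "\<Lambda> \<subseteq> {..<d} \<rightarrow>\<^sub>E UNIV"
  shows "initial_indices d \<Lambda> = \<Lambda>"
proof -
  have "restrict k {..<d} = k" if "k \<in> \<Lambda>" for k
    using that assms by (metis PiE_restrict subsetD)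
  then show ?thesis by (simp add: initial_indices_def)
qed

lemma cbc_constructible_if_prime_large:
  assumes "finite \<Lambda>" "\<Lambda> \<subseteq> {..<d} \<rightarrow>\<^sub>E UNIV" "prime n"
    and "card \<Lambda> * card (mirrored d \<Lambda>) < n" "2 * max_component d \<Lambda> < n"
  shows "cbc_constructible d n \<Lambda>"
proof -
  have "\<exists>z \<in> {..<s} \<rightarrow>\<^sub>E {1..int n - 1}.
      \<forall>t\<le>s. reconstruction_condition t n z (initial_indices t \<Lambda>)" if "s \<le> d" for s
    using that
  proof (induction s)
    case 0
    show ?case using reconstruction_condition_0 by auto
  next
    case (Suc s)
    then obtain z where z: "z \<in> {..<s} \<rightarrow>\<^sub>E {1..int n - 1}"
      and cond: "\<And>t. t \<le> s \<Longrightarrow> reconstruction_condition t n z (initial_indices t \<Lambda>)"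
      by auto
    from Suc.prems have "s < d" by simp
    then obtain c where c: "c \<in> {1..int n - 1}"
      "reconstruction_condition (Suc s) n (z(s := c)) (initial_indices (Suc s) \<Lambda>)"
      using reconstruction_condition_extend[OF assms(1,3) _ assms(4,5) cond[OF order_refl]] by blast
    have "z(s := c) \<in> {..<Suc s} \<rightarrow>\<^sub>E {1..int n - 1}"
      using z c(1) by (auto simp: PiE_iff extensional_def)
    moreover have "reconstruction_condition t n (z(s := c)) (initial_indices t \<Lambda>)"
      if "t \<le> Suc s" for t
    proof (cases "t = Suc s")
      case False
      then have "t \<le> s" using that by simp
      then show ?thesis
        using cond reconstruction_condition_cong[of t "z(s := c)" z] by simp
    qed (use c in simp)
    ultimately show ?case by blast
  qed
  then obtain z where z: "z \<in> {..<d} \<rightarrow>\<^sub>E {1..int n - 1}"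
    "\<forall>t\<le>d. reconstruction_condition t n z (initial_indices t \<Lambda>)" by blast
  then have "reconstruction_condition d n z \<Lambda>"
    using initial_indices_full[OF assms(2)] by (metis order_refl)
  with z show ?thesis
    unfolding cbc_constructible_def
    using reconstruction_condition_extend[OF assms(1,3) _ assms(4,5)] by (metis atLeastAtMost_iff)
qed

theorem lemma16:
  fixes d n :: nat and \<Lambda> :: "(nat \<Rightarrow> nat) set"
  assumes "finite \<Lambda>" and "\<Lambda> \<subseteq> {..<d} \<rightarrow>\<^sub>E UNIV" and "n \<ge> 1"
  shows "(\<forall>z \<in> {..<d} \<rightarrow>\<^sub>E UNIV.
            reconstructs d n z \<Lambda> \<longleftrightarrow> reconstruction_condition d n z \<Lambda>) \<and>
         (prime n \<and> n > max (card \<Lambda> * card (mirrored d \<Lambda>)) (2 * max_component d \<Lambda>) \<longrightarrow>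
            cbc_constructible d n \<Lambda>)"
proof (intro conjI ballI impI)
  fix z :: "nat \<Rightarrow> int"
  show "reconstructs d n z \<Lambda> \<longleftrightarrow> reconstruction_condition d n z \<Lambda>"
    using assms by (rule reconstructs_iff)
next
  assume "prime n \<and> n > max (card \<Lambda> * card (mirrored d \<Lambda>)) (2 * max_component d \<Lambda>)"
  then show "cbc_constructible d n \<Lambda>"
    using assms by (intro cbc_constructible_if_prime_large) auto
qed

end
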